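(* Let $\mathcal{L}$ be a general linear system of conics in $\mathbb{P}^2$ (over $\mathbb{C}$) of affine dimension $3$ and of rank $3$. Then the Weddle locus $W(\mathcal{L})\subset\mathbb{P}^2$ splits as the union of $3$ lines.
   Context: We work over $\mathbb{C}$. Let $n\ge 1$ and let $[x_0:\dots:x_n]$ be homogeneous coordinates on $\mathbb{P}^n$. A linear system $\mathcal{L}$ of quadrics in $\mathbb{P}^n$ is (the projectivization of) a linear subspace of the space of quadratic forms in $x_0,\dots,x_n$; its (affine) dimension $\dim\mathcal{L}$ is the dimension of this vector subspace. Suppose $\dim\mathcal{L}\le n+1$ and let $Q_0,\dots,Q_n$ be generators of $\mathcal{L}$. The Weddle matrix of $\mathcal{L}$ is the $(n+1)\times(n+1)$ matrix of linear forms $\mathbf{W}_{\mathcal{L}}=\big[\partial Q_k/\partial x_i\big]_{i,k=0,\dots,n}$ ($i$ row index, $k$ column index), and the Weddle locus of $\mathcal{L}$ is $W(\mathcal{L})=\{P\in\mathbb{P}^n : \det\mathbf{W}_{\mathcal{L}}|_P=0\}$. The rank of $\mathcal{L}$ is the minimal $r$ such that there are linear forms $l_1,\dots,l_r$ in $x_0,\dots,x_n$ with $\mathcal{L}\subseteq\langle l_1^2,\dots,l_r^2\rangle$ (equivalently, the partially symmetric rank of the associated tensor). "General linear system of rank $r$": consider the parameter space of pairs $((l_1,\dots,l_r),A)$, where the $l_i$ are linear forms in $x_0,\dots,x_n$ and $A=(A_{ik})$ is an $r\times(n+1)$ complex matrix, to which one associates the system generated by $Q_k=\sum_{i=1}^r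 A_{ik}l_i^2$, $k=0,\dots,n$. A property holds for the general linear system of dimension $n+1$ and rank $r$ if there is a nonempty Zariski open subset of this parameter space such that the property holds for every system of dimension $n+1$ and rank $r$ arising from a point of that subset. *)

theory Defs
  imports "HOL-Analysis.Analysis" "HOL-Library.Function_Algebras"
begin

text \<open>
  Vectors in \<^typ>\<open>complex^'n\<close> are the affine representatives of points of a projective space of
  dimension \<open>CARD('n) - 1\<close>.  Since the ground field is infinite, quadratic forms are
  identified with the polynomial functions they induce on \<^typ>\<open>complex^'n\<close>.
\<close>

definition scale_fun :: "complex \<Rightarrow> ('a \<Rightarrow> complex) \<Rightarrow> 'a \<Rightarrow> complex" where
  "scale_fun c f = (\<lambda>x. c * f x)"

global_interpretation forms: vector_space "scale_fun :: complex \<Rightarrow> ('a \<Rightarrow> complex) \<Rightarrow> 'a \<Rightarrow> complex"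
  by standard (auto simp: scale_fun_def fun_eq_iff algebra_simps)

definition linear_form :: "complex^'n \<Rightarrow> complex^'n \<Rightarrow> complex" where
  "linear_form a = (\<lambda>x. \<Sum>j\<in>UNIV. a $ j * x $ j)"

definition linear_form_sq :: "complex^'n \<Rightarrow> complex^'n \<Rightarrow> complex" where
  "linear_form_sq a = (\<lambda>x. (linear_form a x)\<^sup>2)"

definition quadratic_forms :: "(complex^'n \<Rightarrow> complex) set" where
  "quadratic_forms = {q. \<exists>c :: complex^'n^'n. q = (\<lambda>x. \<Sum>i\<in>UNIV. \<Sum>j\<in>UNIV. c $ i $ j * x $ i * x $ j)}"

definition linear_system_of_quadrics :: "(complex^'n \<Rightarrow> complex) set \<Rightarrow> bool" where
  "linear_system_of_quadrics L \<longleftrightarrow> forms.subspace L \<and> L \<subseteq> quadratic_forms"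

text \<open>
  By polarization the squares of linear forms span the quadratic forms, so for a linear system of
  quadrics the minimum below is taken over a nonempty set.
\<close>

definition quadric_rank :: "(complex^'n \<Rightarrow> complex) set \<Rightarrow> nat" where
  "quadric_rank L = (LEAST r. \<exists>l :: nat \<Rightarrow> complex^'n. L \<subseteq> forms.span ((\<lambda>i. linear_form_sq (l i)) ` {..<r}))"

definition proj_space :: "(complex^'n) set set" where
  "proj_space = {P. vec.subspace P \<and> vec.dim P = 1}"

definition projective_line :: "(complex^'n) set set \<Rightarrow> bool" where
  "projective_line X \<longleftrightarrow> (\<exists>V. vec.subspace V \<and> vec.dim V = 2 \<and> X = {P \<in> proj_space. P \<subseteq> V})"

definition partial_deriv :: "'n \<Rightarrow> (complex^'n \<Rightarrow> complex) \<Rightarrow> complex^'n \<Rightarrow> complex" where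
  "partial_deriv i q x = deriv (\<lambda>t. q (x + t *s axis i 1)) 0"

definition weddle_matrix :: "('n \<Rightarrow> complex^'n \<Rightarrow> complex) \<Rightarrow> complex^'n \<Rightarrow> complex^'n^'n" where
  "weddle_matrix Q x = (\<chi> i k. partial_deriv i (Q k) x)"

text \<open>
  The family of generators is indexed by the coordinates, so its length is \<open>CARD('n)\<close>; it exists
  exactly if the dimension of the system is at most \<open>CARD('n)\<close>, and the locus does not depend on
  its choice, see \<open>weddle_locus_generators\<close> below.
\<close>

definition weddle_locus :: "(complex^'n \<Rightarrow> complex) set \<Rightarrow> (complex^'n) set set" where
  "weddle_locus L = {P \<in> proj_space. \<exists>Q :: 'n \<Rightarrow> complex^'n \<Rightarrow> complex.
     forms.span (range Q) = L \<and> (\<forall>x\<in>P. det (weddle_matrix Q x) = 0)}"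

lemma quadratic_form_line_differentiable:
  assumes "q \<in> quadratic_forms"
  shows "(\<lambda>t. q (x + t *s axis i 1)) field_differentiable at z"
proof -
  obtain c where q: "q = (\<lambda>x. \<Sum>i\<in>UNIV. \<Sum>j\<in>UNIV. c $ i $ j * x $ i * x $ j)"
    using assms by (auto simp: quadratic_forms_def)
  show ?thesis
    unfolding q by (auto intro!: derivative_intros)
qed

lemma partial_deriv_combination:
  assumes "\<And>k. k \<in> K \<Longrightarrow> Q k \<in> quadratic_forms"
  shows "partial_deriv i (\<Sum>k\<in>K. scale_fun (b k) (Q k)) x = (\<Sum>k\<in>K. b k * partial_deriv i (Q k) x)"
proof -
  have eval: "(\<Sum>k\<in>K. scale_fun (b k) (Q k)) y = (\<Sum>k\<in>K. b k * Q k y)" for y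
    by (induction K rule: infinite_finite_induct) (auto simp: scale_fun_def)
  have "((\<lambda>t. \<Sum>k\<in>K. b k * Q k (x + t *s axis i 1)) has_field_derivative
      (\<Sum>k\<in>K. b k * partial_deriv i (Q k) x)) (at 0)"
    unfolding partial_deriv_def
    by (intro DERIV_sum DERIV_cmult)
      (use assms quadratic_form_line_differentiable field_differentiable_derivI in blast)
  thus ?thesis
    unfolding partial_deriv_def eval by (rule DERIV_imp_deriv)
qed

lemma weddle_det_vanishing:
  fixes Q Q' :: "'n::finite \<Rightarrow> complex^'n \<Rightarrow> complex"
  assumes "range Q \<subseteq> quadratic_forms" and "range Q' \<subseteq> forms.span (range Q)"
    and "det (weddle_matrix Q x) = 0"
  shows "det (weddle_matrix Q' x) = 0"
proof -
  have "\<exists>b. Q' k = (\<Sum>j\<in>UNIV. scale_fun (b j) (Q j))" for k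
  proof -
    have *: "\<exists>b. q = (\<Sum>j\<in>UNIV. scale_fun (b j) (Q j))" if "q \<in> forms.span (range Q)" for q
      using that
    proof (induction rule: forms.span_induct_alt)
      case base
      show ?case by (rule exI[of _ "\<lambda>_. 0"]) simp
    next
      case (step c u q)
      then obtain b j where b: "q = (\<Sum>j\<in>UNIV. scale_fun (b j) (Q j))" and u: "u = Q j" by auto
      have "scale_fun c u = (\<Sum>i\<in>UNIV. scale_fun (if i = j then c else 0) (Q i))"
        unfolding u by (subst sum.remove[of _ j]) auto
      hence "scale_fun c u + q = (\<Sum>i\<in>UNIV. scale_fun ((if i = j then c else 0) + b i) (Q i))"
        unfolding b forms.scale_left_distrib sum.distrib by simp
      thus ?case by (intro exI[of _ "\<lambda>i. (if i = j then c else 0) + b i"])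
    qed
    show ?thesis by (rule *) (use assms(2) in auto)
  qed
  then obtain B where B: "\<And>k. Q' k = (\<Sum>j\<in>UNIV. scale_fun (B k j) (Q j))"
    by metis
  have "weddle_matrix Q' x = weddle_matrix Q x ** (\<chi> j k. B k j)"
    using assms(1)
    by (auto simp: weddle_matrix_def matrix_matrix_mult_def vec_eq_iff B mult.commute
        partial_deriv_combination image_subset_iff)
  thus ?thesis
    using assms(3) by (simp add: det_mul)
qed

lemma weddle_locus_generators:
  assumes "linear_system_of_quadrics L" and "forms.span (range Q) = L"
  shows "weddle_locus L = {P \<in> proj_space. \<forall>x\<in>P. det (weddle_matrix Q x) = 0}"
proof -
  have "det (weddle_matrix Q x) = 0"
    if "forms.span (range Q') = L" "det (weddle_matrix Q' x) = 0" for Q' x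
    using assms that forms.span_superset[of "range Q"] forms.span_superset[of "range Q'"]
    by (intro weddle_det_vanishing[of Q' Q]) (auto simp: linear_system_of_quadrics_def)
  thus ?thesis
    using assms(2) unfolding weddle_locus_def by blast
qed

text \<open>
  A parameter \<open>(l, A)\<close> consists of \<open>CARD('r)\<close> linear forms, given by their coefficient vectors,
  and a matrix with \<open>CARD('r)\<close> rows and \<open>CARD('n)\<close> columns.
\<close>

definition generator :: "complex^'n^'r \<Rightarrow> complex^'n^'r \<Rightarrow> 'n \<Rightarrow> complex^'n \<Rightarrow> complex" where
  "generator l A k = (\<Sum>i\<in>UNIV. scale_fun (A $ i $ k) (linear_form_sq (l $ i)))"

definition system_of :: "complex^'n^'r \<Rightarrow> complex^'n^'r \<Rightarrow> (complex^'n \<Rightarrow> complex) set" where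
  "system_of l A = forms.span (range (generator l A))"

lemma linear_form_sq_quadratic: "linear_form_sq a \<in> quadratic_forms"
  unfolding quadratic_forms_def linear_form_sq_def linear_form_def
  by (auto intro!: exI[of _ "\<chi> i j. a $ i * a $ j"] simp: fun_eq_iff power2_eq_square sum_product
      mult_ac)

lemma subspace_quadratic_forms: "forms.subspace quadratic_forms"
proof (unfold forms.subspace_def, intro conjI ballI allI)
  show "0 \<in> (quadratic_forms :: (complex^'n \<Rightarrow> complex) set)"
    by (auto simp: quadratic_forms_def fun_eq_iff intro!: exI[of _ 0])
next
  fix p q :: "complex^'n \<Rightarrow> complex" assume "p \<in> quadratic_forms" "q \<in> quadratic_forms"
  then obtain c d where
    "p = (\<lambda>x. \<Sum>i\<in>UNIV. \<Sum>j\<in>UNIV. c $ i $ j * x $ i * x $ j)"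
    "q = (\<lambda>x. \<Sum>i\<in>UNIV. \<Sum>j\<in>UNIV. d $ i $ j * x $ i * x $ j)"
    by (auto simp: quadratic_forms_def)
  thus "p + q \<in> quadratic_forms"
    by (auto simp: quadratic_forms_def fun_eq_iff sum.distrib[symmetric] algebra_simps
        intro!: exI[of _ "c + d"])
next
  fix p :: "complex^'n \<Rightarrow> complex" and a assume "p \<in> quadratic_forms"
  then obtain c where "p = (\<lambda>x. \<Sum>i\<in>UNIV. \<Sum>j\<in>UNIV. c $ i $ j * x $ i * x $ j)"
    by (auto simp: quadratic_forms_def)
  thus "scale_fun a p \<in> quadratic_forms"
    by (auto simp: quadratic_forms_def fun_eq_iff scale_fun_def sum_distrib_left algebra_simps
        intro!: exI[of _ "\<chi> i j. a * c $ i $ j"])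
qed

lemma linear_system_of_quadrics_system_of: "linear_system_of_quadrics (system_of l A)"
proof -
  have "range (generator l A) \<subseteq> quadratic_forms"
    by (auto simp: generator_def intro!: forms.subspace_sum[OF subspace_quadratic_forms]
        forms.subspace_scale[OF subspace_quadratic_forms] linear_form_sq_quadratic)
  thus ?thesis
    unfolding linear_system_of_quadrics_def system_of_def
    using forms.span_minimal[OF _ subspace_quadratic_forms] by auto
qed

inductive param_polynomial :: "((complex^'n^'r) \<times> (complex^'n^'r) \<Rightarrow> complex) \<Rightarrow> bool" where
  const: "param_polynomial (\<lambda>_. c)"
| form_coeff: "param_polynomial (\<lambda>p. fst p $ i $ j)"
| matrix_entry: "param_polynomial (\<lambda>p. snd p $ i $ k)"
| add: "param_polynomial f \<Longrightarrow> param_polynomial g \<Longrightarrow> param_polynomial (\<lambda>p. f p + g p)"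
| mult: "param_polynomial f \<Longrightarrow> param_polynomial g \<Longrightarrow> param_polynomial (\<lambda>p. f p * g p)"

definition zariski_open :: "((complex^'n^'r) \<times> (complex^'n^'r)) set \<Rightarrow> bool" where
  "zariski_open U \<longleftrightarrow>
     (\<exists>F. (\<forall>f\<in>F. param_polynomial f) \<and> - U = {p. \<forall>f\<in>F. f p = 0})"

definition holds_for_general_system ::
  "'r::finite itself \<Rightarrow> ((complex^'n \<Rightarrow> complex) set \<Rightarrow> bool) \<Rightarrow> bool" where
  "holds_for_general_system _ \<Phi> \<longleftrightarrow>
     (\<exists>U :: ((complex^'n^'r) \<times> (complex^'n^'r)) set. zariski_open U \<and> U \<noteq> {} \<and>
        (\<forall>(l, A)\<in>U. forms.dim (system_of l A) = CARD('n) \<longrightarrow> quadric_rank (system_of l A) = CARD('r)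
           \<longrightarrow> \<Phi> (system_of l A)))"

end

theory Submission
  imports Defs
begin

text \<open>
  For \<open>Q\<^sub>k = \<Sum>\<^sub>j A\<^sub>j\<^sub>k l\<^sub>j\<^sup>2\<close> with as many linear forms as coordinates, the Weddle matrix at \<open>x\<close> factors
  as \<open>l\<^sup>T \<cdot> diag (2 l\<^sub>j(x)) \<cdot> A\<close>.  Its determinant is a constant times \<open>det l \<cdot> det A \<cdot> \<Prod>\<^sub>j l\<^sub>j(x)\<close>, so on the
  open set \<open>det l \<cdot> det A \<noteq> 0\<close> the Weddle locus is the union of the hyperplanes \<open>l\<^sub>j = 0\<close>, which are
  distinct because the \<open>l\<^sub>j\<close> are linearly independent.
\<close>

text \<open>Reads the forms \<open>l $ j\<close> as the coordinates of \<open>x\<close> after the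
  linear change of variables \<open>l\<close>; both the dimension count and the distinctness of the
  hyperplanes rest on this.\<close>

lemma linear_form_nth: "linear_form (l $ j) x = (l *v x) $ j"
  by (simp add: linear_form_def matrix_vector_mult_def)

lemma partial_deriv_linear_form_sq:
  "partial_deriv i (linear_form_sq a) x = 2 * linear_form a x * a $ i"
proof -
  \<comment> \<open>Along the \<open>i\<close>-th axis only the coordinate \<open>i\<close> moves,
    so the form is affine in \<open>t\<close> with slope \<open>a $ i\<close>.\<close>
  have line: "linear_form a (x + t *s axis i 1) = linear_form a x + t * a $ i" for t
  proof -
    have "(\<Sum>j\<in>UNIV. a $ j * (t * axis i 1 $ j)) = (\<Sum>j\<in>UNIV. if j = i then t * a $ i else 0)"
      by (rule sum.cong) (auto simp: axis_def)
    thus ?thesis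
      by (simp add: linear_form_def algebra_simps sum.distrib)
  qed
  have "((\<lambda>t. (linear_form a x + t * a $ i)\<^sup>2) has_field_derivative 2 * linear_form a x * a $ i) (at 0)"
    by (auto intro!: derivative_eq_intros)
  thus ?thesis
    unfolding partial_deriv_def linear_form_sq_def line by (rule DERIV_imp_deriv)
qed

lemma weddle_matrix_generator:
  fixes l A :: "complex^'n^'n"
  shows "weddle_matrix (generator l A) x =
    transpose l ** (\<chi> i j. if i = j then 2 * linear_form (l $ j) x else 0) ** A"
proof -
  have "partial_deriv i (generator l A k) x =
      (\<Sum>j\<in>UNIV. l $ j $ i * (2 * linear_form (l $ j) x) * A $ j $ k)" for i k
    unfolding generator_def
    by (simp add: partial_deriv_combination linear_form_sq_quadratic partial_deriv_linear_form_sq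
        mult_ac)
  thus ?thesis
    by (simp add: vec_eq_iff weddle_matrix_def matrix_matrix_mult_def transpose_def if_distrib
        cong: if_cong)
qed

lemma det_weddle_matrix_generator:
  fixes l A :: "complex^'n^'n"
  shows "det (weddle_matrix (generator l A) x) =
    det l * (\<Prod>j\<in>UNIV. 2 * linear_form (l $ j) x) * det A"
  by (simp add: weddle_matrix_generator det_mul det_transpose det_diagonal)

text \<open>The determinant formula only gives, for each vector of \<open>P\<close>, a form
  vanishing there, and the form may depend on the vector. As \<open>P\<close> is one-dimensional, a
  form that vanishes at a spanning vector vanishes on all of \<open>P\<close>.\<close>

lemma weddle_locus_system_of:
  fixes l A :: "complex^'n^'n"
  assumes "det l \<noteq> 0" "det A \<noteq> 0"
  shows "weddle_locus (system_of l A) =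
    (\<Union>j. {P \<in> proj_space. P \<subseteq> {x. linear_form (l $ j) x = 0}})"
proof -
  have "(\<forall>x\<in>P. \<exists>j. linear_form (l $ j) x = 0) \<longleftrightarrow> (\<exists>j. P \<subseteq> {x. linear_form (l $ j) x = 0})"
    if P: "P \<in> proj_space" for P
  proof
    assume *: "\<forall>x\<in>P. \<exists>j. linear_form (l $ j) x = 0"
    obtain B where B: "B \<subseteq> P" "P \<subseteq> vec.span B" "card B = 1"
      using P vec.basis_exists[of P] unfolding proj_space_def by (metis (lifting) mem_Collect_eq)
    then obtain v where v: "v \<in> P" "P \<subseteq> vec.span {v}"
      by (auto simp: card_1_singleton_iff)
    then obtain j where j: "linear_form (l $ j) v = 0"
      using * by blast
    have "linear_form (l $ j) (c *s v) = c * linear_form (l $ j) v" for c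
      by (simp add: linear_form_def sum_distrib_left mult_ac)
    hence "vec.span {v} \<subseteq> {x. linear_form (l $ j) x = 0}"
      using j by (auto simp: vec.span_singleton)
    thus "\<exists>j. P \<subseteq> {x. linear_form (l $ j) x = 0}"
      using v by blast
  qed blast
  hence "(\<forall>x\<in>P. det (weddle_matrix (generator l A) x) = 0) \<longleftrightarrow>
      (\<exists>j. P \<subseteq> {x. linear_form (l $ j) x = 0})" if "P \<in> proj_space" for P
    using assms that by (simp add: det_weddle_matrix_generator)
  thus ?thesis
    \<comment> \<open>The locus does not depend on the generators, so \<open>generator l A\<close>
      may be used to compute it.\<close>
    by (subst weddle_locus_generators[OF linear_system_of_quadrics_system_of])
      (auto simp: system_of_def)
qed

lemma subspace_linear_form_kernel: "vec.subspace {x. linear_form a x = 0}"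
  by (auto simp: vec.subspace_def linear_form_def algebra_simps sum.distrib
      simp flip: sum_distrib_left)

text \<open>The inverse of \<open>l\<close> maps the coordinate hyperplane \<open>y $ j = 0\<close>
  isomorphically onto the kernel.\<close>

lemma dim_linear_form_kernel:
  fixes l :: "complex^'n^'n"
  assumes "det l \<noteq> 0"
  shows "vec.dim {x. linear_form (l $ j) x = 0} = CARD('n) - 1"
proof -
  obtain l' where l': "l ** l' = mat 1" "l' ** l = mat 1"
    using assms by (metis invertible_def invertible_det_nz)
  have inv: "l *v (l' *v y) = y" "l' *v (l *v y) = y" for y
    using l' by (simp_all add: matrix_vector_mul_assoc)
  let ?H = "{y :: complex^'n. y $ j = 0}"
  have "{x. linear_form (l $ j) x = 0} = (*v) l' ` ?H"
    by (auto simp: linear_form_nth inv image_iff intro!: exI[of _ "l *v _"])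
  moreover have "vec.dim ((*v) l' ` ?H) = vec.dim ?H"
    by (rule vec.dim_image_eq) (auto intro!: inj_onI matrix_vector_mul_linear_gen
        dest: arg_cong[of _ _ "(*v) l"] simp: inv)
  moreover have "vec.dim ?H = card (- {j})"
    using dim_substandard_cart[of "- {j}"] by simp
  ultimately show ?thesis
    by (simp add: Compl_eq_Diff_UNIV card_Diff_singleton)
qed

text \<open>Ensures that the lines are counted without repetition. Two hyperplanes are separated by
  a vector of the basis dual to the rows of \<open>l\<close>.\<close>

lemma projective_hyperplanes_inj:
  fixes l :: "complex^'n^'n"
  assumes "det l \<noteq> 0"
  shows "inj (\<lambda>j. {P \<in> proj_space. P \<subseteq> {x. linear_form (l $ j) x = 0}})"
proof (rule injI, rule ccontr)
  fix i j
  assume eq: "{P \<in> proj_space. P \<subseteq> {x. linear_form (l $ i) x = 0}} =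
      {P \<in> proj_space. P \<subseteq> {x. linear_form (l $ j) x = 0}}" and "i \<noteq> j"
  \<comment> \<open>\<open>v\<close> is the \<open>j\<close>-th column of the inverse of
    \<open>l\<close>: every form \<open>l $ i\<close> with \<open>i\<close> different from
    \<open>j\<close> vanishes at it, while \<open>l $ j\<close> takes the value 1.\<close>
  obtain v where v: "l *v v = axis j 1"
    using assms by (metis invertible_def invertible_det_nz matrix_vector_mul_assoc matrix_vector_mul_lid)
  have vi: "linear_form (l $ i) v = 0" and vj: "linear_form (l $ j) v \<noteq> 0"
    using \<open>i \<noteq> j\<close> by (simp_all add: linear_form_nth v axis_def)
  have "v \<noteq> 0"
    using vj by (auto simp: linear_form_def)
  hence "vec.span {v} \<in> proj_space"
    by (simp add: proj_space_def)
  moreover have "vec.span {v} \<subseteq> {x. linear_form (l $ i) x = 0}"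
    using vi by (intro vec.span_minimal subspace_linear_form_kernel) auto
  ultimately have "v \<in> {x. linear_form (l $ j) x = 0}"
    using eq vec.span_base[of v "{v}"] by blast
  thus False
    using vj by simp
qed

lemma param_polynomial_sum:
  "(\<And>s. s \<in> S \<Longrightarrow> param_polynomial (f s)) \<Longrightarrow> param_polynomial (\<lambda>p. \<Sum>s\<in>S. f s p)"
  by (induction S rule: infinite_finite_induct) (auto intro: param_polynomial.intros)

lemma param_polynomial_prod:
  "(\<And>s. s \<in> S \<Longrightarrow> param_polynomial (f s)) \<Longrightarrow> param_polynomial (\<lambda>p. \<Prod>s\<in>S. f s p)"
  by (induction S rule: infinite_finite_induct) (auto intro: param_polynomial.intros)

text \<open>The complement is the zero set of the single function \<open>det l * det A\<close>,
  which the Leibniz expansion shows to be polynomial in the parameters.\<close>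

lemma zariski_open_nondegenerate:
  "zariski_open {(l, A). det l \<noteq> 0 \<and> det (A :: complex^'n^'n) \<noteq> 0}"
proof -
  have "param_polynomial (\<lambda>p :: (complex^'n^'n) \<times> (complex^'n^'n). det (fst p) * det (snd p))"
    unfolding det_def
    by (intro param_polynomial.intros param_polynomial_sum param_polynomial_prod)
  thus ?thesis
    unfolding zariski_open_def
    by (intro exI[of _ "{\<lambda>p. det (fst p) * det (snd p)}"]) auto
qed

theorem proposition3p3:
  shows "holds_for_general_system TYPE(3) (\<lambda>L :: (complex^3 \<Rightarrow> complex) set.
    \<exists>lines. card lines = 3 \<and> (\<forall>X\<in>lines. projective_line X) \<and> weddle_locus L = \<Union>lines)"
proof -
  let ?U = "{(l, A). det l \<noteq> 0 \<and> det A \<noteq> 0} :: ((complex^3^3) \<times> (complex^3^3)) set"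
  \<comment> \<open>The witness is the system generated by the squares of the coordinates.\<close>
  have "(mat 1, mat 1) \<in> ?U"
    by simp
  hence "?U \<noteq> {}"
    by blast
  moreover have "\<exists>lines. card lines = 3 \<and> (\<forall>X\<in>lines. projective_line X) \<and>
      weddle_locus (system_of l A) = \<Union>lines" if "det l \<noteq> 0" "det A \<noteq> 0" for l A :: "complex^3^3"
  proof (intro exI conjI ballI)
    let ?X = "\<lambda>j. {P \<in> proj_space. P \<subseteq> {x. linear_form (l $ j) x = 0}}"
    show "card (range ?X) = 3"
      using card_image[OF projective_hyperplanes_inj[OF that(1)]] by simp
    \<comment> \<open>In three variables the kernel has dimension 3 - 1 = 2, as a projective line
      requires.\<close>
    show "projective_line X" if "X \<in> range ?X" for X
      using that subspace_linear_form_kernel dim_linear_form_kernel[OF \<open>det l \<noteq> 0\<close>]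
      unfolding projective_line_def by fastforce
    show "weddle_locus (system_of l A) = \<Union>(range ?X)"
      using that by (rule weddle_locus_system_of)
  qed
  ultimately show ?thesis
    unfolding holds_for_general_system_def
    by (intro exI[of _ ?U] conjI zariski_open_nondegenerate) auto
qed

end
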